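(* Let $n$ be the number of bins and let $M = n^{1-\delta} < n/\log n$ be the number of memory bits, where $\delta$ may depend on $n$. Consider any memory-bounded online allocation strategy (as described in the context) that places $n$ balls, one at a time, each into one of two bins chosen independently and uniformly at random from the $n$ bins, using only $M$ bits of memory. Then, with probability $1-o(1)$ as $n\to\infty$, at the end of the process the heaviest bin contains at least $\frac{\delta \log n}{2\log\log n}$ balls.
   Context: Memory-bounded allocation model: there are $n$ bins $\{1,\dots,n\}$ and $n$ balls arriving sequentially. The strategy has a memory state $m_t\in\{0,1\}^M$ before ball $t$ (with $m_1$ fixed). For ball $t$, two bins $a_t,b_t$ are chosen independently and uniformly at random from $\{1,\dots,n\}$ (independently of everything else), and the strategy may also use fresh independent random bits $r_t$. The ball is placed into bin $c_t=f(m_t,a_t,b_t,r_t)\in\{a_t,b_t\}$ and the memory is updated to $m_{t+1}=g(m_t,a_t,b_t,r_t)$, for some functions $f,g$. Thus the choice of where to put a ball depends only on the $M$ memory bits, the two offered bins, and random bits. The load of a bin is the number of balls placed in it. *)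

theory Defs
  imports "HOL-Probability.Probability"
begin

type_synonym memory = "bool list"
type_synonym bits = "nat \<Rightarrow> bool"

text \<open>The fresh random bits available for one ball: an infinite sequence of independent fair coin
  flips, so that a strategy may use any finite, or even unbounded, number of them.\<close>

definition random_bits :: "bits measure" where
  "random_bits = (\<Pi>\<^sub>M j\<in>UNIV. measure_pmf (bernoulli_pmf (1/2)))"

text \<open>Outcomes are triples \<open>(a, b, r)\<close>: for the balls \<open>t = 0, \<dots>, n - 1\<close>, the bins \<open>a t\<close> and \<open>b t\<close>
  are uniform on \<open>{1..n}\<close>, \<open>r t\<close> is the sequence of random bits, and all of these are independent.\<close>

definition bin_choices :: "nat \<Rightarrow> (nat \<Rightarrow> nat) measure" where
  "bin_choices n = (\<Pi>\<^sub>M t\<in>{..<n}. uniform_count_measure {1..n})"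

definition allocation_space ::
    "nat \<Rightarrow> ((nat \<Rightarrow> nat) \<times> (nat \<Rightarrow> nat) \<times> (nat \<Rightarrow> bits)) measure" where
  "allocation_space n =
     bin_choices n \<Otimes>\<^sub>M bin_choices n \<Otimes>\<^sub>M (\<Pi>\<^sub>M t\<in>{..<n}. random_bits)"

text \<open>\<open>m1\<close> is the initial memory state, \<open>f\<close> the placement rule and \<open>g\<close> the memory update rule.
  They are constrained only on memory states of exactly \<open>M\<close> bits and on actual bins. The
  dependence on the random bits has to be measurable for the process to be a random one; there is
  no such restriction if only finitely many bits are read.\<close>

definition strategy ::
    "nat \<Rightarrow> nat \<Rightarrow> memory \<Rightarrow> (memory \<Rightarrow> nat \<Rightarrow> nat \<Rightarrow> bits \<Rightarrow> nat) \<Rightarrow>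
       (memory \<Rightarrow> nat \<Rightarrow> nat \<Rightarrow> bits \<Rightarrow> memory) \<Rightarrow> bool" where
  "strategy n M m1 f g \<longleftrightarrow>
     length m1 = M \<and>
     (\<forall>m a b. length m = M \<longrightarrow> a \<in> {1..n} \<longrightarrow> b \<in> {1..n} \<longrightarrow>
        (\<forall>r. f m a b r \<in> {a, b} \<and> length (g m a b r) = M) \<and>
        f m a b \<in> random_bits \<rightarrow>\<^sub>M count_space UNIV \<and>
        g m a b \<in> random_bits \<rightarrow>\<^sub>M count_space UNIV)"

text \<open>The memory state before ball \<open>t\<close>; counting balls from \<open>0\<close>, the first one sees \<open>m1\<close>.\<close>

fun mem ::
    "memory \<Rightarrow> (memory \<Rightarrow> nat \<Rightarrow> nat \<Rightarrow> bits \<Rightarrow> memory) \<Rightarrow>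
       (nat \<Rightarrow> nat) \<times> (nat \<Rightarrow> nat) \<times> (nat \<Rightarrow> bits) \<Rightarrow> nat \<Rightarrow> memory" where
  "mem m1 g (a, b, r) 0 = m1"
| "mem m1 g (a, b, r) (Suc t) = g (mem m1 g (a, b, r) t) (a t) (b t) (r t)"

fun placement ::
    "memory \<Rightarrow> (memory \<Rightarrow> nat \<Rightarrow> nat \<Rightarrow> bits \<Rightarrow> nat) \<Rightarrow>
       (memory \<Rightarrow> nat \<Rightarrow> nat \<Rightarrow> bits \<Rightarrow> memory) \<Rightarrow>
       (nat \<Rightarrow> nat) \<times> (nat \<Rightarrow> nat) \<times> (nat \<Rightarrow> bits) \<Rightarrow> nat \<Rightarrow> nat" where
  "placement m1 f g (a, b, r) t = f (mem m1 g (a, b, r) t) (a t) (b t) (r t)"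

definition load ::
    "nat \<Rightarrow> memory \<Rightarrow> (memory \<Rightarrow> nat \<Rightarrow> nat \<Rightarrow> bits \<Rightarrow> nat) \<Rightarrow>
       (memory \<Rightarrow> nat \<Rightarrow> nat \<Rightarrow> bits \<Rightarrow> memory) \<Rightarrow>
       (nat \<Rightarrow> nat) \<times> (nat \<Rightarrow> nat) \<times> (nat \<Rightarrow> bits) \<Rightarrow> nat \<Rightarrow> nat" where
  "load n m1 f g \<omega> i = card {t. t < n \<and> placement m1 f g \<omega> t = i}"

definition max_load ::
    "nat \<Rightarrow> memory \<Rightarrow> (memory \<Rightarrow> nat \<Rightarrow> nat \<Rightarrow> bits \<Rightarrow> nat) \<Rightarrow>
       (memory \<Rightarrow> nat \<Rightarrow> nat \<Rightarrow> bits \<Rightarrow> memory) \<Rightarrow>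
       (nat \<Rightarrow> nat) \<times> (nat \<Rightarrow> nat) \<times> (nat \<Rightarrow> bits) \<Rightarrow> nat" where
  "max_load n m1 f g \<omega> = Max (load n m1 f g \<omega> ` {1..n})"

end

(* Fix k >= 2, divide the n balls into k blocks and let eta = 1/(2k). Call a bin good for a memory
   state m if in state m it receives the next ball with probability at least eta/n. If B is the set
   of the other bins, a ball goes to B whenever both offered bins are in B, so
   (|B|/n)^2 <= |B| eta/n and |B| <= eta n. Hence for any k states at least half of all bins are
   good for all of them.

   The invariant after j blocks is: for all sequences tau of k - j states, at least
   sigma_j = n/2 / (64 k^2)^j bins have load at least j and are good for all states in tau.
   During the next block, whatever the state m is, sigma_j of the bins of load j are good for
   tau' = (tau, m), so for a fixed tau the number of bins of load j + 1 that are good for tau grows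
   by one with probability of order sigma_j eta/n per ball. An exponential supermartingale shows
   that it stays below sigma_(j+1) with probability at most exp(-3 sigma_(j+1)), which beats the
   number 2^(M(k-j-1)) of sequences tau as long as sigma_(j+1) >= M k. For
   k = ceiling(delta ln n / (2 ln ln n)) this holds up to j + 1 = k - 1, and the last block needs
   no union bound. *)

theory Submission
  imports Defs "HOL-Real_Asymp.Real_Asymp"
begin

section \<open>Allocation processes driven by a finite-state kernel\<close>

lemma measure_bind_pmf_eq:
  "measure_pmf.prob (bind_pmf p f) A = (\<integral>x. measure_pmf.prob (f x) A \<partial>measure_pmf p)"
proof -
  have "ennreal (measure_pmf.prob (bind_pmf p f) A) = (\<integral>\<^sup>+x. emeasure (measure_pmf (f x)) A \<partial>measure_pmf p)"
    by (simp add: measure_pmf.emeasure_eq_measure [symmetric])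
  also have "\<dots> = (\<integral>\<^sup>+x. ennreal (measure_pmf.prob (f x) A) \<partial>measure_pmf p)"
    by (simp add: measure_pmf.emeasure_eq_measure)
  also have "\<dots> = ennreal (\<integral>x. measure_pmf.prob (f x) A \<partial>measure_pmf p)"
    by (intro nn_integral_eq_integral measure_pmf.integrable_const_bound[where B=1]) auto
  finally show ?thesis
    by (simp add: integral_nonneg_AE)
qed

lemma measure_bind_pmf_le:
  fixes p :: "'a pmf" and f :: "'a \<Rightarrow> 'b pmf"
  assumes "\<And>x. x \<in> set_pmf p \<Longrightarrow> measure_pmf.prob (f x) A \<le> u x"
    and "integrable (measure_pmf p) u"
  shows "measure_pmf.prob (bind_pmf p f) A \<le> (\<integral>x. u x \<partial>measure_pmf p)"
  unfolding measure_bind_pmf_eq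
proof (rule integral_mono_AE)
  show "integrable (measure_pmf p) (\<lambda>x. measure_pmf.prob (f x) A)"
    by (rule measure_pmf.integrable_const_bound[where B=1]) auto
qed (use assms in \<open>auto simp: AE_measure_pmf_iff\<close>)

text \<open>\<open>cs\<close> lists the bins hit so far, newest first. The set is not confined to
  \<open>{1..n}\<close>; where bins are counted it is intersected with a set of actual bins.\<close>

definition heavy :: "nat \<Rightarrow> nat list \<Rightarrow> nat set" where
  "heavy j cs = {i. j \<le> count_list cs i}"

lemma heavy_0 [simp]: "heavy 0 cs = UNIV"
  by (simp add: heavy_def)

lemma heavy_Cons_mono: "heavy j cs \<subseteq> heavy j (c # cs)"
  by (auto simp: heavy_def)

lemma heavy_Suc_Cons: "c \<in> heavy j cs \<Longrightarrow> c \<in> heavy (Suc j) (c # cs)"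
  by (auto simp: heavy_def)

text \<open>\<open>K m\<close> is the joint law, in memory state \<open>m\<close>, of the bin that receives the next ball and the
  next state. The condition \<open>forced\<close> is all that remains of the two choices: the ball goes to \<open>B\<close>
  if both offered bins lie in \<open>B\<close>.\<close>

locale allocation_kernel =
  fixes n :: nat and St :: "'s set" and K :: "'s \<Rightarrow> (nat \<times> 's) pmf"
  assumes n_pos: "0 < n"
    and finite_St: "finite St"
    and set_K: "m \<in> St \<Longrightarrow> set_pmf (K m) \<subseteq> {1..n} \<times> St"
    and forced: "m \<in> St \<Longrightarrow> B \<subseteq> {1..n} \<Longrightarrow>
      (real (card B) / real n)\<^sup>2 \<le> measure_pmf.prob (K m) (B \<times> UNIV)"
begin

definition step :: "nat list \<times> 's \<Rightarrow> (nat list \<times> 's) pmf" where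
  "step h = map_pmf (\<lambda>(c, m). (c # fst h, m)) (K (snd h))"

text \<open>The recursion splits off the first ball, so an induction on the number of balls may vary
  the starting pair.\<close>

primrec run :: "nat \<Rightarrow> nat list \<times> 's \<Rightarrow> (nat list \<times> 's) pmf" where
  "run 0 h = return_pmf h"
| "run (Suc t) h = bind_pmf (step h) (run t)"

definition good :: "real \<Rightarrow> 's \<Rightarrow> nat set" where
  "good \<eta> m = {i \<in> {1..n}. \<eta> / n \<le> measure_pmf.prob (K m) ({i} \<times> UNIV)}"

text \<open>The explicit range makes \<open>core \<eta> []\<close> the set of all bins, which is
  what the last block ends with.\<close>

definition core :: "real \<Rightarrow> 's list \<Rightarrow> nat set" where
  "core \<eta> \<tau> = {i \<in> {1..n}. \<forall>m\<in>set \<tau>. i \<in> good \<eta> m}"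

lemma finite_core [simp]: "finite (core \<eta> \<tau>)"
  by (simp add: core_def)

lemma core_Cons: "core \<eta> (m # \<tau>) = core \<eta> \<tau> \<inter> good \<eta> m"
  by (auto simp: core_def good_def)

lemma prob_K_sum:
  assumes "finite A"
  shows "measure_pmf.prob (K m) (A \<times> UNIV) = (\<Sum>i\<in>A. measure_pmf.prob (K m) ({i} \<times> UNIV))"
proof -
  have "A \<times> UNIV = (\<Union>i\<in>A. {i} \<times> (UNIV :: 's set))" by auto
  then show ?thesis
    using assms measure_pmf.finite_measure_finite_Union[of A "\<lambda>i. {i} \<times> UNIV" "K m"]
    by (auto simp: disjoint_family_on_def)
qed

lemma prob_hit_good:
  assumes "A \<subseteq> good \<eta> m"
  shows "card A * (\<eta> / n) \<le> measure_pmf.prob (K m) (A \<times> UNIV)"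
proof -
  have "finite A" using assms by (auto simp: good_def intro: finite_subset)
  then show ?thesis
    unfolding prob_K_sum[OF \<open>finite A\<close>]
    using assms by (intro sum_bounded_below) (auto simp: good_def)
qed

text \<open>The lower bound \<open>forced\<close> is quadratic in the number of bins that are not
  good, the upper bound from the threshold \<open>\<eta> / n\<close> only linear; cancelling one
  factor bounds that number.\<close>

lemma card_not_good:
  fixes \<eta> :: real
  assumes "m \<in> St" and "0 \<le> \<eta>"
  shows "card ({1..n} - good \<eta> m) \<le> \<eta> * n"
proof -
  define B where "B = {1..n} - good \<eta> m"
  have "(card B / n)\<^sup>2 \<le> measure_pmf.prob (K m) (B \<times> UNIV)"
    using assms(1) by (intro forced) (auto simp: B_def)
  also have "\<dots> = (\<Sum>i\<in>B. measure_pmf.prob (K m) ({i} \<times> UNIV))"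
    by (rule prob_K_sum) (simp add: B_def)
  also have "\<dots> \<le> card B * (\<eta> / n)"
    by (rule sum_bounded_above) (auto simp: B_def good_def)
  finally have "real (card B) * card B \<le> card B * (\<eta> * n)"
    using n_pos by (simp add: power2_eq_square field_simps)
  moreover have "0 \<le> \<eta> * n" using assms(2) by simp
  ultimately show ?thesis
    unfolding B_def[symmetric] by (cases "card B = 0") auto
qed

lemma card_core:
  fixes \<eta> :: real
  assumes "set \<tau> \<subseteq> St" and "0 \<le> \<eta>"
  shows "n - length \<tau> * (\<eta> * n) \<le> card (core \<eta> \<tau>)"
  using assms(1)
proof (induction \<tau>)
  case Nil
  have "core \<eta> [] = {1..n}" by (auto simp: core_def)
  then show ?case by simp
next
  case (Cons m \<tau>)
  have "core \<eta> \<tau> \<subseteq> core \<eta> (m # \<tau>) \<union> ({1..n} - good \<eta> m)"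
    by (auto simp: core_def)
  then have "card (core \<eta> \<tau>) \<le> card (core \<eta> (m # \<tau>)) + card ({1..n} - good \<eta> m)"
    by (meson card_Un_le card_mono finite_Diff finite_UnI finite_atLeastAtMost finite_core le_trans)
  moreover have "card ({1..n} - good \<eta> m) \<le> \<eta> * n"
    using Cons.prems assms(2) by (intro card_not_good) auto
  ultimately show ?case
    using Cons by (simp add: algebra_simps)
qed

lemma step_cases:
  assumes "h' \<in> set_pmf (step (cs, m))" and "m \<in> St"
  obtains c m' where "h' = (c # cs, m')" "c \<in> {1..n}" "m' \<in> St"
  using assms set_K[OF assms(2)] by (force simp: step_def)

text \<open>Loads never decrease, so a level once reached stays reached, in later blocks as well as
  for the balls left over at the end.\<close>

lemma run_mono:
  assumes "h' \<in> set_pmf (run t h)" and "snd h \<in> St"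
  shows "snd h' \<in> St \<and> heavy j (fst h) \<subseteq> heavy j (fst h')"
  using assms
proof (induction t arbitrary: h)
  case 0
  then show ?case by simp
next
  case (Suc t)
  obtain cs m where h: "h = (cs, m)" by fastforce
  from Suc.prems(1) obtain h1 where h1: "h1 \<in> set_pmf (step h)" "h' \<in> set_pmf (run t h1)"
    by auto
  obtain c m1 where *: "h1 = (c # cs, m1)" "c \<in> {1..n}" "m1 \<in> St"
    using h1(1) Suc.prems(2) step_cases unfolding h by (metis snd_conv)
  show ?case
    using Suc.IH[OF h1(2)] * h heavy_Cons_mono[of j cs c] by auto
qed

lemma run_add: "run (s + t) h = bind_pmf (run s h) (run t)"
  by (induction s arbitrary: h) (simp_all add: bind_return_pmf bind_assoc_pmf cong: bind_pmf_cong)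

section \<open>Growth of one load level during a block\<close>

text \<open>As long as fewer than \<open>\<sigma>'\<close> bins of \<open>A\<close> have reached load \<open>j + 1\<close>, at least \<open>\<sigma> / 2\<close> bins of \<open>A\<close>
  that are good for the current state have load exactly \<open>j\<close>. So each step increases the number
  \<open>X\<close> of bins of load \<open>j + 1\<close> with probability at least \<open>\<sigma> \<eta> / (2 n)\<close>, whatever the memory does,
  and \<open>exp (\<sigma>' - X)\<close> decays geometrically in expectation.\<close>

lemma prob_few_heavy:
  fixes \<sigma> \<sigma>' \<eta> :: real
  assumes A: "A \<subseteq> {1..n}" and \<eta>: "0 \<le> \<eta>" "\<eta> \<le> 1" and \<sigma>: "0 \<le> \<sigma>" "2 * \<sigma>' \<le> \<sigma>"
    and "snd h \<in> St"
    and "\<And>m. m \<in> St \<Longrightarrow> \<sigma> \<le> card (A \<inter> good \<eta> m \<inter> heavy j (fst h))"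
  shows "measure_pmf.prob (run i h) {h'. card (A \<inter> heavy (Suc j) (fst h')) < \<sigma>'}
    \<le> exp (\<sigma>' - card (A \<inter> heavy (Suc j) (fst h))) * (1 - \<sigma> * \<eta> / (4 * n)) ^ i"
  using assms(6,7)
proof (induction i arbitrary: h)
  case 0
  then show ?case by (auto simp: indicator_def)
next
  case (Suc i)
  define bad where "bad = {h' :: nat list \<times> 's. card (A \<inter> heavy (Suc j) (fst h')) < \<sigma>'}"
  define X where "X h' = card (A \<inter> heavy (Suc j) (fst h'))" for h' :: "nat list \<times> 's"
  \<comment> \<open>A set of \<open>\<sigma> / 2\<close> good bins is hit with probability at least
    \<open>\<sigma> * \<eta> / (2 * n)\<close>, and a hit halves the bound; this accounts for the
    4.\<close>
  define q where "q = 1 - \<sigma> * \<eta> / (4 * n)"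
  have finA: "finite A" using A finite_subset by blast
  obtain cs m where h: "h = (cs, m)" by fastforce
  have m: "m \<in> St" using Suc.prems(1) h by simp
  have "\<sigma> \<le> card (A \<inter> good \<eta> m \<inter> heavy j cs)" using Suc.prems(2)[OF m] h by simp
  also have "\<dots> \<le> card {1..n}" using A by (intro of_nat_mono card_mono) auto
  finally have "\<sigma> \<le> n" by simp
  then have "\<sigma> * \<eta> \<le> real n * 1" using \<eta> \<sigma> by (intro mult_mono) auto
  then have q0: "0 \<le> q" using n_pos by (simp add: q_def field_simps)
  show ?case
  proof (cases "X h < \<sigma>'")
    case False
    have "measure_pmf.prob (run (Suc i) h) bad = 0"
    proof -
      have "h' \<notin> bad" if "h' \<in> set_pmf (run (Suc i) h)" for h'
      proof -
        have "X h \<le> X h'" unfolding X_def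
          using run_mono[OF that Suc.prems(1), of "Suc j"] finA by (intro card_mono) auto
        then show ?thesis using False by (simp add: bad_def X_def)
      qed
      then show ?thesis by (auto simp: measure_pmf_zero_iff)
    qed
    then show ?thesis using q0 by (simp add: bad_def q_def)
  next
    case True
    \<comment> \<open>These bins have load exactly \<open>j\<close>, so a ball in one of them raises
      \<open>X\<close> by one.\<close>
    define T where "T = A \<inter> good \<eta> m \<inter> heavy j cs - heavy (Suc j) cs"
    define C where "C = exp (\<sigma>' - X h) * q ^ i"
    \<comment> \<open>Bounds the failure probability of the remaining \<open>i\<close> balls given
      the first one; the head of the list is the bin it went to. A hit of \<open>T\<close> saves a
      factor 1/2, since \<open>exp (- 1)\<close> is at most 1/2.\<close>
    define u where "u h' = C * (1 - indicator (T \<times> UNIV) (hd (fst h'), snd h') / 2)"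
      for h' :: "nat list \<times> 's"
    have C0: "0 \<le> C" using q0 by (simp add: C_def)
    have le_u: "measure_pmf.prob (run i h') bad \<le> u h'" if h': "h' \<in> set_pmf (step h)" for h'
    proof -
      obtain c m' where h'_eq: "h' = (c # cs, m')" and cm: "c \<in> {1..n}" "m' \<in> St"
        using h' m step_cases unfolding h by metis
      have "\<sigma> \<le> card (A \<inter> good \<eta> m0 \<inter> heavy j (fst h'))" if "m0 \<in> St" for m0
      proof -
        have "\<sigma> \<le> card (A \<inter> good \<eta> m0 \<inter> heavy j (fst h))" by (rule Suc.prems(2)[OF that])
        also have "\<dots> \<le> card (A \<inter> good \<eta> m0 \<inter> heavy j (fst h'))"
          using finA heavy_Cons_mono[of j cs c] h h'_eq by (intro of_nat_mono card_mono) auto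
        finally show ?thesis .
      qed
      then have IH: "measure_pmf.prob (run i h') bad \<le> exp (\<sigma>' - X h') * q ^ i"
        unfolding bad_def X_def q_def using cm h'_eq by (intro Suc.IH) auto
      have "X h + indicator T c \<le> X h'"
      proof (cases "c \<in> T")
        case False
        then show ?thesis unfolding X_def h h'_eq
          using finA heavy_Cons_mono[of "Suc j" cs c] by (auto intro!: card_mono)
      next
        case True
        then have c: "c \<in> A" "c \<in> heavy j cs" "c \<notin> heavy (Suc j) cs" by (auto simp: T_def)
        have "insert c (A \<inter> heavy (Suc j) cs) \<subseteq> A \<inter> heavy (Suc j) (c # cs)"
          using c heavy_Suc_Cons heavy_Cons_mono by blast
        then have "card (insert c (A \<inter> heavy (Suc j) cs)) \<le> card (A \<inter> heavy (Suc j) (c # cs))"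
          using finA by (intro card_mono) auto
        then show ?thesis using True c finA by (simp add: X_def h h'_eq)
      qed
      then have "real (X h) + indicator T c \<le> X h'"
        by (cases "c \<in> T") auto
      then have "exp (\<sigma>' - X h') \<le> exp (\<sigma>' - X h) * exp (- indicator T c)"
        by (simp add: exp_add[symmetric])
      also have "\<dots> \<le> exp (\<sigma>' - X h) * (1 - indicator T c / 2)"
      proof -
        have "exp (- 1 :: real) \<le> 1 / 2"
          using exp_ge_add_one_self[of "1::real"] by (simp add: exp_minus field_simps)
        then show ?thesis by (auto simp: indicator_def)
      qed
      finally have "exp (\<sigma>' - X h') * q ^ i \<le> exp (\<sigma>' - X h) * (1 - indicator T c / 2) * q ^ i"
        using q0 by (intro mult_right_mono) auto
      with IH show ?thesis
        by (simp add: u_def C_def h'_eq indicator_times mult_ac)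
    qed
    have intu: "integrable (measure_pmf (step h)) u"
      by (intro measure_pmf.integrable_const_bound[where B=C])
         (use C0 in \<open>auto simp: u_def indicator_def\<close>)
    have "measure_pmf.prob (run (Suc i) h) bad \<le> (\<integral>h'. u h' \<partial>measure_pmf (step h))"
      unfolding run.simps using le_u intu by (rule measure_bind_pmf_le)
    also have "\<dots> = (\<integral>x. C * (1 - indicator (T \<times> UNIV) x / 2) \<partial>measure_pmf (K m))"
      by (simp add: step_def h u_def case_prod_unfold)
    also have "\<dots> = C * (1 - measure_pmf.prob (K m) (T \<times> UNIV) / 2)"
      by (simp add: measure_pmf.integrable_const_bound[where B=1])
    also have "\<dots> \<le> C * q"
    proof -
      \<comment> \<open>The bins lost in passing to \<open>T\<close> already have load above
        \<open>j\<close>. They are counted by \<open>X\<close>, which is less than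
        \<open>\<sigma>' \<le> \<sigma> / 2\<close>.\<close>
      have "card (A \<inter> good \<eta> m \<inter> heavy j cs) \<le> card T + card (A \<inter> heavy (Suc j) cs)"
        using finA by (intro order.trans[OF card_mono card_Un_le]) (auto simp: T_def)
      then have "\<sigma> \<le> card T + X h" using Suc.prems(2)[OF m] by (simp add: X_def h)
      then have "\<sigma> / 2 \<le> card T" using True \<sigma>(2) by linarith
      then have "\<sigma> / 2 * (\<eta> / n) \<le> card T * (\<eta> / n)"
        using \<eta> by (intro mult_right_mono) auto
      also have "\<dots> \<le> measure_pmf.prob (K m) (T \<times> UNIV)"
        by (rule prob_hit_good) (auto simp: T_def)
      finally show ?thesis using C0 by (intro mult_left_mono) (auto simp: q_def mult_ac)
    qed
    finally show ?thesis by (simp add: C_def bad_def X_def q_def mult_ac)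
  qed
qed


section \<open>Chaining the blocks\<close>

text \<open>The quantification over \<open>k - j\<close> states is what keeps the invariant alive: in the block that
  leads to \<open>j + 1\<close>, the current state uses up one of them.\<close>

definition spread :: "real \<Rightarrow> nat \<Rightarrow> (nat \<Rightarrow> real) \<Rightarrow> nat \<Rightarrow> nat list \<times> 's \<Rightarrow> bool" where
  "spread \<eta> k \<sigma> j h \<longleftrightarrow> (\<forall>\<tau>. set \<tau> \<subseteq> St \<and> length \<tau> = k - j \<longrightarrow>
     \<sigma> j \<le> card (core \<eta> \<tau> \<inter> heavy j (fst h)))"

text \<open>For a fixed \<open>\<tau>\<close>, the invariant for all \<open>m # \<tau>\<close> says
  that \<open>core \<eta> \<tau>\<close> has enough heavy good bins whatever the current state
  \<open>m\<close> is, so \<open>prob_few_heavy\<close> applies. A union bound over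
  \<open>\<tau>\<close> gives the power of \<open>card St\<close>.\<close>

lemma spread_step:
  assumes \<eta>: "0 \<le> \<eta>" "\<eta> \<le> 1" and \<sigma>: "0 \<le> \<sigma> j" "2 * \<sigma> (Suc j) \<le> \<sigma> j" and "j < k"
    and h: "snd h \<in> St" "spread \<eta> k \<sigma> j h"
  shows "measure_pmf.prob (run L h) {h'. \<not> spread \<eta> k \<sigma> (Suc j) h'}
    \<le> real (card St) ^ (k - Suc j) * exp (\<sigma> (Suc j) - \<sigma> j * \<eta> * L / (4 * n))"
proof -
  define Ts where "Ts = {\<tau>. set \<tau> \<subseteq> St \<and> length \<tau> = k - Suc j}"
  define bad where "bad \<tau> = {h' :: nat list \<times> 's.
    card (core \<eta> \<tau> \<inter> heavy (Suc j) (fst h')) < \<sigma> (Suc j)}" for \<tau>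
  have finTs: "finite Ts" unfolding Ts_def by (rule finite_lists_length_eq[OF finite_St])
  have spread: "\<sigma> j \<le> card (core \<eta> \<tau> \<inter> good \<eta> m \<inter> heavy j (fst h))"
    if "\<tau> \<in> Ts" "m \<in> St" for \<tau> m
  proof -
    have "set (m # \<tau>) \<subseteq> St" "length (m # \<tau>) = k - j"
      using that \<open>j < k\<close> by (auto simp: Ts_def)
    then have "\<sigma> j \<le> card (core \<eta> (m # \<tau>) \<inter> heavy j (fst h))"
      using h(2) unfolding spread_def by blast
    then show ?thesis by (simp add: core_Cons)
  qed
  have single: "measure_pmf.prob (run L h) (bad \<tau>)
      \<le> exp (\<sigma> (Suc j) - \<sigma> j * \<eta> * L / (4 * n))" if "\<tau> \<in> Ts" for \<tau>
  proof -
    define p where "p = \<sigma> j * \<eta> / (4 * n)"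
    have "measure_pmf.prob (run L h) (bad \<tau>)
        \<le> exp (\<sigma> (Suc j) - card (core \<eta> \<tau> \<inter> heavy (Suc j) (fst h))) * (1 - p) ^ L"
      unfolding bad_def p_def using that \<eta> \<sigma> h spread
      by (intro prob_few_heavy) (auto simp: core_def)
    also have "\<dots> \<le> exp (\<sigma> (Suc j)) * exp (- p) ^ L"
    proof (intro mult_mono power_mono)
      show "1 - p \<le> exp (- p)" using exp_ge_add_one_self[of "- p"] by simp
      have "\<sigma> j \<le> card (core \<eta> \<tau> \<inter> good \<eta> (snd h) \<inter> heavy j (fst h))"
        using that h by (intro spread)
      also have "\<dots> \<le> card {1..n}"
        by (intro of_nat_mono card_mono) (auto simp: core_def)
      finally have "\<sigma> j * \<eta> \<le> real n * 1" using \<eta> \<sigma> by (intro mult_mono) auto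
      then show "0 \<le> 1 - p" using n_pos by (simp add: p_def field_simps)
      then show "0 \<le> (1 - p) ^ L" by simp
    qed auto
    also have "\<dots> = exp (\<sigma> (Suc j) - \<sigma> j * \<eta> * L / (4 * n))"
      by (simp add: p_def exp_of_nat_mult[symmetric] exp_add[symmetric] mult_ac)
    finally show ?thesis .
  qed
  have "{h'. \<not> spread \<eta> k \<sigma> (Suc j) h'} \<subseteq> (\<Union>\<tau>\<in>Ts. bad \<tau>)"
    by (auto simp: spread_def Ts_def bad_def not_le)
  then have "measure_pmf.prob (run L h) {h'. \<not> spread \<eta> k \<sigma> (Suc j) h'}
      \<le> measure_pmf.prob (run L h) (\<Union>\<tau>\<in>Ts. bad \<tau>)"
    by (intro measure_pmf.finite_measure_mono) auto
  also have "\<dots> \<le> (\<Sum>\<tau>\<in>Ts. measure_pmf.prob (run L h) (bad \<tau>))"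
    using finTs by (intro measure_pmf.finite_measure_subadditive_finite) auto
  also have "\<dots> \<le> card Ts * exp (\<sigma> (Suc j) - \<sigma> j * \<eta> * L / (4 * n))"
    by (rule sum_bounded_above) (rule single)
  also have "card Ts = card St ^ (k - Suc j)"
    unfolding Ts_def by (rule card_lists_length_eq[OF finite_St])
  finally show ?thesis by simp
qed

text \<open>A level is missed only if the previous one was missed already or the block fails from a
  pair satisfying the invariant; averaging over the pair reached so far adds up these
  failures.\<close>

lemma spread_run:
  assumes \<eta>: "0 \<le> \<eta>" "\<eta> \<le> 1" and \<sigma>: "\<And>j. 0 \<le> \<sigma> j" "\<And>j. 2 * \<sigma> (Suc j) \<le> \<sigma> j"
    and h: "snd h \<in> St" "spread \<eta> k \<sigma> 0 h" and "j \<le> k"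
  shows "measure_pmf.prob (run (j * L) h) {h'. \<not> spread \<eta> k \<sigma> j h'}
    \<le> (\<Sum>i<j. real (card St) ^ (k - Suc i) * exp (\<sigma> (Suc i) - \<sigma> i * \<eta> * L / (4 * n)))"
  using \<open>j \<le> k\<close>
proof (induction j)
  case 0
  then show ?case using h by (simp add: indicator_def)
next
  case (Suc j)
  define c where "c = real (card St) ^ (k - Suc j) * exp (\<sigma> (Suc j) - \<sigma> j * \<eta> * L / (4 * n))"
  define bad where "bad j = {h'. \<not> spread \<eta> k \<sigma> j h'}" for j
  have "measure_pmf.prob (run (j * L + L) h) (bad (Suc j))
      \<le> (\<integral>h'. indicator (bad j) h' + c \<partial>measure_pmf (run (j * L) h))"
    unfolding run_add
  proof (rule measure_bind_pmf_le)
    fix h' assume h': "h' \<in> set_pmf (run (j * L) h)"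
    have "0 \<le> c" by (simp add: c_def)
    show "measure_pmf.prob (run L h') (bad (Suc j)) \<le> indicator (bad j) h' + c"
    proof (cases "h' \<in> bad j")
      case True
      then show ?thesis using \<open>0 \<le> c\<close> by (simp add: add_increasing2)
    next
      case False
      then have "spread \<eta> k \<sigma> j h'" by (simp add: bad_def)
      moreover have "snd h' \<in> St" using run_mono[OF h' h(1)] by blast
      ultimately have "measure_pmf.prob (run L h') (bad (Suc j)) \<le> c"
        unfolding c_def bad_def using \<eta> \<sigma> Suc.prems by (intro spread_step) auto
      then show ?thesis using False by simp
    qed
  qed (auto intro!: measure_pmf.integrable_const_bound[where B="1 + c"] simp: c_def indicator_def)
  also have "\<dots> = measure_pmf.prob (run (j * L) h) (bad j) + c"
    by (subst Bochner_Integration.integral_add)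
       (auto intro!: measure_pmf.integrable_const_bound[where B=1])
  finally show ?case
    using Suc by (simp add: c_def bad_def add.commute)
qed

text \<open>With \<open>\<eta> = 1 / (2 k)\<close> the bins that are good for \<open>k\<close> given states still make up half of all
  bins, and each block of \<open>n div k\<close> balls costs a factor of order \<open>k\<^sup>2\<close>.\<close>

lemma prob_no_heavy:
  fixes k :: nat and y :: real
  assumes k: "1 \<le> k" "k \<le> n" and m: "m \<in> St"
    and y: "y = n / 2 / (64 * real k ^ 2) ^ k" "1 \<le> y"
    and St: "real (card St) ^ k \<le> exp (64 * real k ^ 2 * y)"
  shows "measure_pmf.prob (run n ([], m)) {h'. heavy k (fst h') \<inter> {1..n} = {}} \<le> 2 * exp (- 3 * y)"
proof -
  define D where "D = 64 * real k ^ 2"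
  define \<eta> where "\<eta> = 1 / (2 * real k)"
  define \<sigma> where "\<sigma> j = n / 2 / D ^ j" for j
  define L where "L = n div k"
  have "1 \<le> real k ^ 2" using k by simp
  then have D: "64 \<le> D" by (simp add: D_def)
  have \<eta>: "0 \<le> \<eta>" "\<eta> \<le> 1" using k by (auto simp: \<eta>_def field_simps)
  have \<sigma>0: "0 \<le> \<sigma> j" for j using D by (simp add: \<sigma>_def)
  have \<sigma>_Suc: "\<sigma> j = D * \<sigma> (Suc j)" for j using D by (simp add: \<sigma>_def)
  have \<sigma>2: "2 * \<sigma> (Suc j) \<le> \<sigma> j" for j
    unfolding \<sigma>_Suc[of j] using D \<sigma>0 by (intro mult_right_mono) auto
  have \<sigma>_k: "\<sigma> k = y" by (simp add: \<sigma>_def y D_def)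
  \<comment> \<open>Rounding down in \<open>n div k\<close> costs at most a factor 2, since
    \<open>L\<close> is at least 1.\<close>
  have "n < k * L + k"
    unfolding L_def using k by (metis add.commute dividend_less_times_div mult.commute not_one_le_zero zero_less_iff_neq_zero)
  moreover have "1 \<le> L" using k by (simp add: L_def div_greater_zero_iff Suc_le_eq)
  then have "k \<le> k * L" by simp
  ultimately have "n \<le> 2 * (k * L)" by linarith
  then have "real n \<le> real (2 * (k * L))" by (rule of_nat_mono)
  then have L: "real n \<le> 2 * k * L" by simp
  have kL: "k * L \<le> n" by (simp add: L_def)
  \<comment> \<open>The 64 in \<open>D\<close> is chosen for this: the right-hand side equals
    \<open>\<sigma> (Suc i) * (8 * k * L / n)\<close>, and \<open>2 * k * L\<close> is at least
    \<open>n\<close>. A block thus fails for one sequence with probability at most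
    \<open>exp (- 3 * \<sigma> (Suc i))\<close>.\<close>
  have exponent: "4 * \<sigma> (Suc i) \<le> \<sigma> i * \<eta> * L / (4 * n)" for i
  proof -
    have "\<sigma> i * \<eta> * L / (4 * n) = \<sigma> (Suc i) * (8 * k * L / n)"
      using k n_pos by (simp add: \<sigma>_Suc[of i] D_def \<eta>_def power2_eq_square)
    also have "\<dots> \<ge> \<sigma> (Suc i) * 4"
      using L n_pos \<sigma>0 by (intro mult_left_mono) (auto simp: field_simps)
    finally show ?thesis by simp
  qed
  have start: "spread \<eta> k \<sigma> 0 ([], m)"
    unfolding spread_def
  proof (intro allI impI)
    fix \<tau> assume \<tau>: "set \<tau> \<subseteq> St \<and> length \<tau> = k - 0"
    have "n - length \<tau> * (\<eta> * n) \<le> card (core \<eta> \<tau>)"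
      using \<tau> \<eta> by (intro card_core) auto
    then show "\<sigma> 0 \<le> card (core \<eta> \<tau> \<inter> heavy 0 (fst ([] :: nat list, m)))"
      using \<tau> k by (simp add: \<sigma>_def \<eta>_def)
  qed
  define bad where "bad = {h' :: nat list \<times> 's. \<not> spread \<eta> k \<sigma> k h'}"
  \<comment> \<open>Before the last block \<open>\<sigma> (Suc i)\<close> is at least
    \<open>D * y\<close>, so the factor \<open>exp (- 3 * D * y)\<close> outweighs the at most
    \<open>exp (D * y)\<close> sequences of states.\<close>
  have late: "real (card St) ^ (k - Suc i) * exp (\<sigma> (Suc i) - \<sigma> i * \<eta> * L / (4 * n)) \<le> exp (- (2 * D * y))"
    if "Suc i < k" for i
  proof -
    have "\<sigma> (Suc i) \<le> \<sigma> i" for i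
      using \<sigma>2[of i] \<sigma>0[of "Suc i"] by linarith
    moreover have "Suc i \<le> k - 1" using that by simp
    ultimately have "\<sigma> (k - 1) \<le> \<sigma> (Suc i)" by (rule lift_Suc_antimono_le)
    moreover have "\<sigma> (k - 1) = D * y" using \<sigma>_Suc[of "k - 1"] \<sigma>_k k by simp
    ultimately have *: "D * y \<le> \<sigma> (Suc i)" by simp
    have "1 \<le> real (card St)" using m finite_St by (simp add: Suc_le_eq card_gt_0_iff) blast
    then have "real (card St) ^ (k - Suc i) \<le> real (card St) ^ k"
      by (intro power_increasing) auto
    then have "real (card St) ^ (k - Suc i) \<le> exp (D * y)" using St by (simp add: D_def)
    then have "real (card St) ^ (k - Suc i) * exp (\<sigma> (Suc i) - \<sigma> i * \<eta> * L / (4 * n))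
        \<le> exp (D * y) * exp (- (3 * (D * y)))"
      using exponent[of i] * by (intro mult_mono) auto
    then show ?thesis by (simp add: exp_add[symmetric] mult.assoc)
  qed
  have "measure_pmf.prob (run (k * L) ([], m)) bad
      \<le> (\<Sum>i<k. real (card St) ^ (k - Suc i) * exp (\<sigma> (Suc i) - \<sigma> i * \<eta> * L / (4 * n)))"
    unfolding bad_def using \<eta> \<sigma>0 \<sigma>2 m start by (intro spread_run) auto
  \<comment> \<open>The last block is split off: only the empty sequence of states remains there, so
    no power of \<open>card St\<close> appears.\<close>
  also have "\<dots> = (\<Sum>i<k - 1. real (card St) ^ (k - Suc i) * exp (\<sigma> (Suc i) - \<sigma> i * \<eta> * L / (4 * n)))
      + exp (\<sigma> k - \<sigma> (k - 1) * \<eta> * L / (4 * n))"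
    using k by (cases k) simp_all
  also have "\<dots> \<le> (\<Sum>i<k - 1. exp (- (2 * D * y))) + exp (- 3 * y)"
    using exponent[of "k - 1"] k \<sigma>_k by (intro add_mono sum_mono late) auto
  also have "(\<Sum>i<k - 1. exp (- (2 * D * y))) \<le> real k * exp (- (2 * D * y))"
    by simp
  also have "\<dots> \<le> exp k * exp (- (2 * D * y))"
    using exp_ge_add_one_self[of "real k"] by (intro mult_right_mono) (linarith, simp)
  also have "\<dots> \<le> exp (- 3 * y)"
  proof -
    have "real k \<le> D"
    proof -
      have "real k * 1 \<le> real k * (64 * real k)" using k by (intro mult_left_mono) auto
      then show ?thesis by (simp add: D_def power2_eq_square)
    qed
    also have "\<dots> \<le> D * y" using D y(2) by simp
    finally have "real k \<le> D * y" .
    moreover have "3 * y \<le> D * y" using D y(2) by (intro mult_right_mono) auto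
    ultimately show ?thesis by (simp add: exp_add[symmetric])
  qed
  finally have main: "measure_pmf.prob (run (k * L) ([], m)) bad \<le> 2 * exp (- 3 * y)" by simp
  \<comment> \<open>The \<open>n - k * L\<close> balls left over cannot lower a load, so one bin of
    load \<open>k\<close> after the blocks is enough; \<open>1 \<le> y\<close> provides it.\<close>
  have "measure_pmf.prob (run (k * L + (n - k * L)) ([], m)) {h'. heavy k (fst h') \<inter> {1..n} = {}}
      \<le> (\<integral>h'. indicator bad h' \<partial>measure_pmf (run (k * L) ([], m)))"
    unfolding run_add
  proof (rule measure_bind_pmf_le)
    fix h' assume h': "h' \<in> set_pmf (run (k * L) ([], m))"
    have St': "snd h' \<in> St" using run_mono[OF h'] m by auto
    show "measure_pmf.prob (run (n - k * L) h') {h'. heavy k (fst h') \<inter> {1..n} = {}} \<le> indicator bad h'"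
    proof (cases "h' \<in> bad")
      case False
      have "core \<eta> [] = {1..n}" by (auto simp: core_def)
      moreover have "\<sigma> k \<le> card (core \<eta> [] \<inter> heavy k (fst h'))"
        using False unfolding bad_def spread_def by simp
      ultimately have "y \<le> card ({1..n} \<inter> heavy k (fst h'))" by (simp add: \<sigma>_k)
      then have "{1..n} \<inter> heavy k (fst h') \<noteq> {}" using y(2) by auto
      then have "heavy k (fst h'') \<inter> {1..n} \<noteq> {}"
        if "h'' \<in> set_pmf (run (n - k * L) h')" for h''
        using run_mono[OF that St', of k] by blast
      then have "measure_pmf.prob (run (n - k * L) h') {h'. heavy k (fst h') \<inter> {1..n} = {}} = 0"
        by (auto simp: measure_pmf_zero_iff)
      then show ?thesis by simp
    qed simp
  qed (auto intro!: measure_pmf.integrable_const_bound[where B=1])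
  with main kL show ?thesis by simp
qed

end

section \<open>The law of the process of a strategy\<close>

text \<open>Shrinks the target to values actually taken, because the rules of a strategy are known
  to be measurable for legal arguments only.\<close>

lemma measurable_into_count_space:
  fixes I :: "'a :: countable set"
  assumes "h \<in> N \<rightarrow>\<^sub>M count_space UNIV" and "\<And>\<omega>. \<omega> \<in> space N \<Longrightarrow> h \<omega> \<in> I"
  shows "h \<in> N \<rightarrow>\<^sub>M count_space I"
  unfolding measurable_count_space_eq2_countable using assms by (auto intro: measurable_sets)

lemma nn_integral_uniform_count_measure:
  assumes "finite S" and "S \<noteq> {}"
  shows "(\<integral>\<^sup>+x. h x \<partial>uniform_count_measure S) = (\<Sum>x\<in>S. h x) / card S"
proof -
  have "0 < card S" using assms by (simp add: card_gt_0_iff)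
  then have "ennreal (1 / real (card S)) = 1 / ennreal (real (card S))"
    by (subst divide_ennreal[symmetric]) auto
  then show ?thesis
    using assms unfolding uniform_count_measure_def
    by (subst nn_integral_point_measure_finite)
       (auto simp: sum_distrib_right[symmetric] divide_ennreal_def mult.commute
          ennreal_of_nat_eq_real_of_nat)
qed

section \<open>Product spaces of the first balls\<close>

lemma prob_space_random_bits: "prob_space random_bits"
  unfolding random_bits_def by (intro prob_space_PiM measure_pmf.prob_space_axioms)

text \<open>Separates the number \<open>t\<close> of balls from the number \<open>n\<close> of bins,
  so that balls can be added one at a time with the bins fixed.\<close>

definition alloc_upto :: "nat \<Rightarrow> nat \<Rightarrow> ((nat \<Rightarrow> nat) \<times> (nat \<Rightarrow> nat) \<times> (nat \<Rightarrow> bits)) measure" where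
  "alloc_upto n t = (\<Pi>\<^sub>M s\<in>{..<t}. uniform_count_measure {1..n}) \<Otimes>\<^sub>M
     (\<Pi>\<^sub>M s\<in>{..<t}. uniform_count_measure {1..n}) \<Otimes>\<^sub>M (\<Pi>\<^sub>M s\<in>{..<t}. random_bits)"

lemma allocation_space_eq: "allocation_space n = alloc_upto n n"
  by (simp add: allocation_space_def alloc_upto_def bin_choices_def)

lemma prob_space_alloc_upto:
  assumes "0 < n"
  shows "prob_space (alloc_upto n t)"
proof -
  have "prob_space (uniform_count_measure {1..n})"
    using assms by (intro prob_space_uniform_count_measure) auto
  then show ?thesis
    unfolding alloc_upto_def
    by (intro prob_space_pair prob_space_PiM prob_space_random_bits)
qed

lemma nn_integral_alloc_upto:
  assumes "0 < n" and G: "G \<in> borel_measurable (alloc_upto n t)"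
  shows "(\<integral>\<^sup>+\<omega>. G \<omega> \<partial>alloc_upto n t) =
    (\<integral>\<^sup>+a. \<integral>\<^sup>+b. \<integral>\<^sup>+r. G (a, b, r)
       \<partial>(\<Pi>\<^sub>M s\<in>{..<t}. random_bits) \<partial>(\<Pi>\<^sub>M s\<in>{..<t}. uniform_count_measure {1..n})
       \<partial>(\<Pi>\<^sub>M s\<in>{..<t}. uniform_count_measure {1..n}))"
proof -
  define A where "A = (\<Pi>\<^sub>M s\<in>{..<t}. uniform_count_measure {1..n})"
  define C where "C = (\<Pi>\<^sub>M s\<in>{..<t}. random_bits)"
  interpret U: prob_space "uniform_count_measure {1..n}"
    using assms(1) by (intro prob_space_uniform_count_measure) auto
  interpret A: prob_space A unfolding A_def by (intro prob_space_PiM U.prob_space_axioms)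
  interpret C: prob_space C unfolding C_def by (intro prob_space_PiM prob_space_random_bits)
  interpret AC: pair_prob_space A C ..
  have [measurable]: "G \<in> borel_measurable (A \<Otimes>\<^sub>M A \<Otimes>\<^sub>M C)"
    using G by (simp add: alloc_upto_def A_def C_def)
  have "(\<integral>\<^sup>+\<omega>. G \<omega> \<partial>(A \<Otimes>\<^sub>M A \<Otimes>\<^sub>M C)) = (\<integral>\<^sup>+a. \<integral>\<^sup>+p. G (a, p) \<partial>(A \<Otimes>\<^sub>M C) \<partial>A)"
    by (rule AC.P.nn_integral_fst[symmetric]) simp
  also have "\<dots> = (\<integral>\<^sup>+a. \<integral>\<^sup>+b. \<integral>\<^sup>+r. G (a, b, r) \<partial>C \<partial>A \<partial>A)"
    by (intro nn_integral_cong C.nn_integral_fst[symmetric]) measurable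
  finally show ?thesis by (simp add: alloc_upto_def A_def C_def)
qed

text \<open>Coordinate \<open>t\<close> is split off each of the three products in turn. The new
  integrals stay next to those they came from; they are rearranged later, where the ones over bins
  are finite sums.\<close>

lemma nn_integral_alloc_upto_Suc:
  assumes n: "0 < n" and G: "G \<in> borel_measurable (alloc_upto n (Suc t))"
  shows "(\<integral>\<^sup>+\<omega>. G \<omega> \<partial>alloc_upto n (Suc t)) =
    (\<integral>\<^sup>+a. \<integral>\<^sup>+x. \<integral>\<^sup>+b. \<integral>\<^sup>+y. \<integral>\<^sup>+r. \<integral>\<^sup>+z. G (a(t := x), b(t := y), r(t := z))
       \<partial>random_bits \<partial>(\<Pi>\<^sub>M s\<in>{..<t}. random_bits)
       \<partial>uniform_count_measure {1..n} \<partial>(\<Pi>\<^sub>M s\<in>{..<t}. uniform_count_measure {1..n})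
       \<partial>uniform_count_measure {1..n} \<partial>(\<Pi>\<^sub>M s\<in>{..<t}. uniform_count_measure {1..n}))"
proof -
  define U where "U = uniform_count_measure {1..n}"
  define A where "A T = (\<Pi>\<^sub>M s\<in>T. U)" for T :: "nat set"
  define C where "C T = (\<Pi>\<^sub>M s\<in>T. random_bits)" for T :: "nat set"
  interpret U: prob_space U
    unfolding U_def using n by (intro prob_space_uniform_count_measure) auto
  interpret R: prob_space random_bits by (rule prob_space_random_bits)
  interpret PU: product_sigma_finite "\<lambda>_ :: nat. U" ..
  interpret PR: product_sigma_finite "\<lambda>_ :: nat. random_bits" ..
  let ?T = "{..<t}"
  let ?T' = "insert t {..<t}"
  interpret A: prob_space "A ?T'" unfolding A_def by (intro prob_space_PiM U.prob_space_axioms)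
  interpret C: prob_space "C ?T'" unfolding C_def by (intro prob_space_PiM R.prob_space_axioms)
  have [measurable]: "G \<in> borel_measurable (A ?T' \<Otimes>\<^sub>M A ?T' \<Otimes>\<^sub>M C ?T')"
    using G by (simp add: alloc_upto_def A_def C_def U_def lessThan_Suc)
  have upd: "a(t := x) \<in> space (A ?T')" if "a \<in> space (A ?T)" "x \<in> space U" for a x
    using that by (auto simp: A_def space_PiM PiE_def extensional_def Pi_def)
  have "(\<integral>\<^sup>+\<omega>. G \<omega> \<partial>alloc_upto n (Suc t)) =
      (\<integral>\<^sup>+a. \<integral>\<^sup>+b. \<integral>\<^sup>+r. G (a, b, r) \<partial>C ?T' \<partial>A ?T' \<partial>A ?T')"
    using nn_integral_alloc_upto[OF n G] by (simp add: A_def C_def U_def lessThan_Suc)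
  also have "\<dots> = (\<integral>\<^sup>+a. \<integral>\<^sup>+x. \<integral>\<^sup>+b. \<integral>\<^sup>+r. G (a(t := x), b, r) \<partial>C ?T' \<partial>A ?T' \<partial>U \<partial>A ?T)"
    unfolding A_def by (rule PU.product_nn_integral_insert) (auto simp: A_def[symmetric])
  also have "\<dots> = (\<integral>\<^sup>+a. \<integral>\<^sup>+x. \<integral>\<^sup>+b. \<integral>\<^sup>+y. \<integral>\<^sup>+r. G (a(t := x), b(t := y), r) \<partial>C ?T' \<partial>U \<partial>A ?T \<partial>U \<partial>A ?T)"
  proof (intro nn_integral_cong)
    fix a x assume "a \<in> space (A ?T)" "x \<in> space U"
    then have [measurable]: "a(t := x) \<in> space (A ?T')" by (rule upd)
    show "(\<integral>\<^sup>+b. \<integral>\<^sup>+r. G (a(t := x), b, r) \<partial>C ?T' \<partial>A ?T') =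
      (\<integral>\<^sup>+b. \<integral>\<^sup>+y. \<integral>\<^sup>+r. G (a(t := x), b(t := y), r) \<partial>C ?T' \<partial>U \<partial>A ?T)"
      unfolding A_def by (rule PU.product_nn_integral_insert) (auto simp: A_def[symmetric])
  qed
  also have "\<dots> = (\<integral>\<^sup>+a. \<integral>\<^sup>+x. \<integral>\<^sup>+b. \<integral>\<^sup>+y. \<integral>\<^sup>+r. \<integral>\<^sup>+z. G (a(t := x), b(t := y), r(t := z))
      \<partial>random_bits \<partial>C ?T \<partial>U \<partial>A ?T \<partial>U \<partial>A ?T)"
  proof (intro nn_integral_cong)
    fix a x b y assume "a \<in> space (A ?T)" "x \<in> space U" "b \<in> space (A ?T)" "y \<in> space U"
    then have [measurable]: "a(t := x) \<in> space (A ?T')" "b(t := y) \<in> space (A ?T')"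
      by (auto intro: upd)
    show "(\<integral>\<^sup>+r. G (a(t := x), b(t := y), r) \<partial>C ?T') =
      (\<integral>\<^sup>+r. \<integral>\<^sup>+z. G (a(t := x), b(t := y), r(t := z)) \<partial>random_bits \<partial>C ?T)"
      unfolding C_def by (rule PR.product_nn_integral_insert) (auto simp: C_def[symmetric])
  qed
  finally show ?thesis by (simp add: A_def C_def U_def)
qed

section \<open>The kernel of a memory-bounded strategy\<close>

locale memory_strategy =
  fixes n M :: nat and m1 :: memory
    and f :: "memory \<Rightarrow> nat \<Rightarrow> nat \<Rightarrow> bits \<Rightarrow> nat" and g :: "memory \<Rightarrow> nat \<Rightarrow> nat \<Rightarrow> bits \<Rightarrow> memory"
  assumes n_pos: "0 < n" and strat: "strategy n M m1 f g"
begin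

definition St :: "memory set" where
  "St = {m. length m = M}"

lemma fg:
  assumes "m \<in> St" "a \<in> {1..n}" "b \<in> {1..n}"
  shows "f m a b r \<in> {a, b}" "g m a b r \<in> St"
    "f m a b \<in> random_bits \<rightarrow>\<^sub>M count_space UNIV" "g m a b \<in> random_bits \<rightarrow>\<^sub>M count_space UNIV"
  using strat assms by (auto simp: strategy_def St_def)

definition R :: "memory \<Rightarrow> nat \<Rightarrow> nat \<Rightarrow> (nat \<times> memory) pmf" where
  "R m a b = Abs_pmf (distr random_bits (count_space UNIV) (\<lambda>r. (f m a b r, g m a b r)))"

definition K :: "memory \<Rightarrow> (nat \<times> memory) pmf" where
  "K m = bind_pmf (pmf_of_set {1..n}) (\<lambda>a. bind_pmf (pmf_of_set {1..n}) (R m a))"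

lemma measurable_fg:
  assumes "m \<in> St" "a \<in> {1..n}" "b \<in> {1..n}"
  shows "(\<lambda>r. (f m a b r, g m a b r)) \<in> random_bits \<rightarrow>\<^sub>M count_space UNIV"
proof -
  note [measurable] = fg(3,4)[OF assms]
  show ?thesis by measurable
qed

text \<open>Pairs of a bin and a memory state form a countable type, so a probability measure on all
  their subsets is discrete and \<open>Abs_pmf\<close> loses nothing.\<close>

lemma measure_R:
  assumes "m \<in> St" "a \<in> {1..n}" "b \<in> {1..n}"
  shows "measure_pmf (R m a b) = distr random_bits (count_space UNIV) (\<lambda>r. (f m a b r, g m a b r))"
    (is "_ = ?D")
proof -
  interpret D: prob_space ?D
    by (intro prob_space.prob_space_distr prob_space_random_bits measurable_fg assms)
  have "AE x in ?D. measure ?D {x} \<noteq> 0"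
    by (intro D.AE_support_countable[THEN iffD2]) (auto intro!: exI[of _ UNIV] countableI_type)
  then show ?thesis
    unfolding R_def by (intro Abs_pmf_inverse) (auto intro: D.prob_space_axioms)
qed

lemma set_R:
  assumes "m \<in> St" "a \<in> {1..n}" "b \<in> {1..n}"
  shows "set_pmf (R m a b) \<subseteq> {a, b} \<times> St"
proof -
  have "AE x in measure_pmf (R m a b). x \<in> {a, b} \<times> St"
    unfolding measure_R[OF assms]
    using fg(1,2)[OF assms] by (subst AE_distr_iff) (auto intro: measurable_fg[OF assms])
  then show ?thesis by (auto simp: AE_measure_pmf_iff)
qed

sublocale allocation_kernel n St K
proof
  show "0 < n" by (rule n_pos)
  have "St = {m. set m \<subseteq> UNIV \<and> length m = M}" by (auto simp: St_def)
  then show "finite St" by (metis finite_lists_length_eq finite)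
next
  fix m assume m: "m \<in> St"
  have ne: "{1..n} \<noteq> {}" using n_pos by simp
  show "set_pmf (K m) \<subseteq> {1..n} \<times> St"
    using set_R[OF m] ne by (fastforce simp: K_def set_bind_pmf set_pmf_of_set)
  fix B :: "nat set" assume B: "B \<subseteq> {1..n}"
  have finB: "finite B" using B finite_subset by blast
  \<comment> \<open>If both offered bins lie in \<open>B\<close>, the ball lands in \<open>B\<close>
    almost surely; all other pairs of bins are bounded below by 0.\<close>
  have "(card B / n)\<^sup>2 = (\<Sum>a\<in>B. (\<Sum>b\<in>B. 1) / n) / n"
    by (simp add: power2_eq_square)
  also have "\<dots> \<le> (\<Sum>a\<in>B. (\<Sum>b\<in>{1..n}. measure_pmf.prob (R m a b) (B \<times> UNIV)) / n) / n"
  proof (intro divide_right_mono sum_mono)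
    fix a assume a: "a \<in> B"
    have "(\<Sum>b\<in>B. 1) \<le> (\<Sum>b\<in>B. measure_pmf.prob (R m a b) (B \<times> UNIV))"
    proof (intro sum_mono)
      fix b assume b: "b \<in> B"
      have "set_pmf (R m a b) \<subseteq> B \<times> UNIV"
        using set_R[OF m, of a b] a b B by blast
      then have "measure_pmf.prob (R m a b) (B \<times> UNIV) = 1"
        by (auto simp: measure_pmf.prob_eq_1 AE_measure_pmf_iff)
      then show "1 \<le> measure_pmf.prob (R m a b) (B \<times> UNIV)" by simp
    qed
    also have "\<dots> \<le> (\<Sum>b\<in>{1..n}. measure_pmf.prob (R m a b) (B \<times> UNIV))"
      by (rule sum_mono2[OF _ B]) auto
    finally show "(\<Sum>b\<in>B. 1) \<le> (\<Sum>b\<in>{1..n}. measure_pmf.prob (R m a b) (B \<times> UNIV))" .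
  qed auto
  also have "\<dots> \<le> (\<Sum>a\<in>{1..n}. (\<Sum>b\<in>{1..n}. measure_pmf.prob (R m a b) (B \<times> UNIV)) / n) / n"
    by (intro divide_right_mono sum_mono2[OF _ B]) (auto intro!: divide_nonneg_nonneg sum_nonneg)
  also have "\<dots> = measure_pmf.prob (K m) (B \<times> UNIV)"
    unfolding K_def measure_bind_pmf_eq using ne by (simp add: integral_pmf_of_set sum_divide_distrib)
  finally show "(card B / n)\<^sup>2 \<le> measure_pmf.prob (K m) (B \<times> UNIV)" .
qed

section \<open>The law of the history\<close>

definition history :: "nat \<Rightarrow> (nat \<Rightarrow> nat) \<times> (nat \<Rightarrow> nat) \<times> (nat \<Rightarrow> bits) \<Rightarrow> nat list \<times> memory" where
  "history t \<omega> = (rev (map (placement m1 f g \<omega>) [0..<t]), mem m1 g \<omega> t)"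

text \<open>The reversal in \<open>history\<close> puts the newest bin at the head, so one more ball
  acts on it as \<open>step\<close> does.\<close>

lemma history_Suc:
  "history (Suc t) (a, b, r) =
    (let (cs, m) = history t (a, b, r) in (f m (a t) (b t) (r t) # cs, g m (a t) (b t) (r t)))"
  by (simp add: history_def)

text \<open>The state before ball \<open>s\<close> depends only on balls with index below
  \<open>s\<close>. This is what makes the data of ball \<open>t\<close> independent of the history
  before it.\<close>

lemma mem_upd:
  assumes "s \<le> t"
  shows "mem m1 g (a(t := x), b(t := y), r(t := z)) s = mem m1 g (a, b, r) s"
  using assms by (induction s) auto

lemma history_upd:
  "history t (a(t := x), b(t := y), r(t := z)) = history t (a, b, r)"
  by (simp add: history_def mem_upd)

lemma space_alloc_upto:
  assumes "(a, b, r) \<in> space (alloc_upto n N)" "s < N"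
  shows "a s \<in> {1..n}" "b s \<in> {1..n}"
  using assms by (auto simp: alloc_upto_def space_pair_measure space_PiM space_uniform_count_measure PiE_def Pi_def)

lemma history_St:
  assumes "\<omega> \<in> space (alloc_upto n N)" "t \<le> N"
  shows "snd (history t \<omega>) \<in> St"
  using assms(2)
proof (induction t)
  case 0
  obtain a b r where "\<omega> = (a, b, r)" by (cases \<omega>)
  then show ?case using strat by (simp add: history_def St_def strategy_def)
next
  case (Suc t)
  obtain a b r where \<omega>: "\<omega> = (a, b, r)" by (cases \<omega>)
  have "snd (history t \<omega>) \<in> St" using Suc by simp
  moreover have "a t \<in> {1..n}" "b t \<in> {1..n}"
    using space_alloc_upto[of a b r N t] assms(1) Suc.prems by (auto simp: \<omega>)
  ultimately show ?case
    using fg(2) by (simp add: \<omega> history_Suc split_beta Let_def)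
qed

text \<open>The rules are measurable in the random bits once history and offered bins are fixed.
  These take countably many values, so they can be made variable one after the other.\<close>

lemma history_measurable:
  assumes "t \<le> N"
  shows "history t \<in> alloc_upto n N \<rightarrow>\<^sub>M count_space UNIV"
  using assms
proof (induction t)
  case 0
  have "history 0 = (\<lambda>_. ([], m1))" by (auto simp: history_def)
  then show ?case by simp
next
  case (Suc t)
  let ?N = "alloc_upto n N"
  have t: "t \<in> {..<N}" using Suc.prems by simp
  have hist: "history t \<in> ?N \<rightarrow>\<^sub>M count_space {h. snd h \<in> St}"
  proof (rule measurable_into_count_space)
    show "history t \<in> ?N \<rightarrow>\<^sub>M count_space UNIV" using Suc by simp
    show "history t \<omega> \<in> {h. snd h \<in> St}" if "\<omega> \<in> space ?N" for \<omega>
      using history_St[OF that, of t] Suc.prems by simp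
  qed
  have "(\<lambda>\<omega>. fst \<omega> t) \<in> ?N \<rightarrow>\<^sub>M uniform_count_measure {1..n}"
    unfolding alloc_upto_def
    by (rule measurable_compose[OF measurable_fst measurable_component_singleton[OF t]])
  then have a: "(\<lambda>\<omega>. fst \<omega> t) \<in> ?N \<rightarrow>\<^sub>M count_space {1..n}"
    by (simp only: measurable_cong_sets[OF refl sets_uniform_count_measure_count_space])
  have "(\<lambda>\<omega>. fst (snd \<omega>) t) \<in> ?N \<rightarrow>\<^sub>M uniform_count_measure {1..n}"
    unfolding alloc_upto_def
    by (rule measurable_compose[OF measurable_compose[OF measurable_snd measurable_fst]
          measurable_component_singleton[OF t]])
  then have b: "(\<lambda>\<omega>. fst (snd \<omega>) t) \<in> ?N \<rightarrow>\<^sub>M count_space {1..n}"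
    by (simp only: measurable_cong_sets[OF refl sets_uniform_count_measure_count_space])
  have r: "(\<lambda>\<omega>. snd (snd \<omega>) t) \<in> ?N \<rightarrow>\<^sub>M random_bits"
    unfolding alloc_upto_def
    by (rule measurable_compose[OF measurable_compose[OF measurable_snd measurable_snd]
          measurable_component_singleton[OF t]])
  define H where "H h x y \<omega> = (f (snd h) x y (snd (snd \<omega>) t) # fst h, g (snd h) x y (snd (snd \<omega>) t))"
    for h :: "nat list \<times> memory" and x y and \<omega> :: "(nat \<Rightarrow> nat) \<times> (nat \<Rightarrow> nat) \<times> (nat \<Rightarrow> bits)"
  have H: "H h x y \<in> ?N \<rightarrow>\<^sub>M count_space UNIV"
    if "snd h \<in> St" "x \<in> {1..n}" "y \<in> {1..n}" for h x y
  proof -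
    have "(\<lambda>p. (fst p # fst h, snd p)) \<in> count_space UNIV \<rightarrow>\<^sub>M count_space UNIV" by simp
    from measurable_compose[OF measurable_compose[OF r measurable_fg[OF that]] this]
    show ?thesis by (simp add: H_def[abs_def])
  qed
  have "(\<lambda>\<omega>. H h x (fst (snd \<omega>) t) \<omega>) \<in> ?N \<rightarrow>\<^sub>M count_space UNIV"
    if "snd h \<in> St" "x \<in> {1..n}" for h x
    by (rule measurable_compose_countable'[where f="H h x", OF H[OF that] b]) auto
  then have "(\<lambda>\<omega>. H h (fst \<omega> t) (fst (snd \<omega>) t) \<omega>) \<in> ?N \<rightarrow>\<^sub>M count_space UNIV"
    if "snd h \<in> St" for h
    by (rule measurable_compose_countable'[where f="\<lambda>x \<omega>. H h x (fst (snd \<omega>) t) \<omega>", OF _ a]) (use that in auto)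
  then have "(\<lambda>\<omega>. H (history t \<omega>) (fst \<omega> t) (fst (snd \<omega>) t) \<omega>) \<in> ?N \<rightarrow>\<^sub>M count_space UNIV"
    by (rule measurable_compose_countable'[where f="\<lambda>h \<omega>. H h (fst \<omega> t) (fst (snd \<omega>) t) \<omega>", OF _ hist])
       (auto intro: countableI_type)
  also have "(\<lambda>\<omega>. H (history t \<omega>) (fst \<omega> t) (fst (snd \<omega>) t) \<omega>) = history (Suc t)"
    by (auto simp: H_def history_Suc split_beta Let_def)
  finally show ?case .
qed

text \<open>The data of ball \<open>t\<close> do not affect the history before it, so integrating
  them out leaves one step of the kernel.\<close>

lemma nn_integral_history_Suc:
  "(\<integral>\<^sup>+\<omega>. F (history (Suc t) \<omega>) \<partial>alloc_upto n (Suc t)) =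
    (\<integral>\<^sup>+\<omega>. (\<integral>\<^sup>+h. F h \<partial>measure_pmf (step (history t \<omega>))) \<partial>alloc_upto n t)"
proof -
  let ?U = "uniform_count_measure {1..n}"
  let ?A = "\<Pi>\<^sub>M s\<in>{..<t}. ?U"
  let ?C = "\<Pi>\<^sub>M s\<in>{..<t}. random_bits"
  define P where "P x y h = (\<integral>\<^sup>+(c, m'). F (c # fst h, m') \<partial>measure_pmf (R (snd h) x y))"
    for x y and h :: "nat list \<times> memory"
  interpret U: prob_space ?U
    using n_pos by (intro prob_space_uniform_count_measure) auto
  interpret A: prob_space ?A by (intro prob_space_PiM U.prob_space_axioms)
  interpret C: prob_space ?C by (intro prob_space_PiM prob_space_random_bits)
  have ne: "{1..n} \<noteq> {}" using n_pos by simp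
  have sumU: "(\<integral>\<^sup>+x. h x \<partial>?U) = (\<Sum>x\<in>{1..n}. h x) / n" for h
    using nn_integral_uniform_count_measure[of "{1..n}" h] ne by simp
  have meas: "(\<lambda>\<omega>. F' (history t \<omega>)) \<in> borel_measurable (alloc_upto n t)"
    for F' :: "nat list \<times> memory \<Rightarrow> ennreal"
    using measurable_compose[OF history_measurable[OF order_refl], of F' borel] by simp
  have [measurable]: "(\<lambda>\<omega>. P x y (history t \<omega>)) \<in> borel_measurable (?A \<Otimes>\<^sub>M ?A \<Otimes>\<^sub>M ?C)" for x y
    using meas[of "P x y"] by (simp add: alloc_upto_def)
  have inner: "(\<integral>\<^sup>+z. F (history (Suc t) (a(t := x), b(t := y), r(t := z))) \<partial>random_bits) =
      P x y (history t (a, b, r))"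
    if "a \<in> space ?A" "b \<in> space ?A" "r \<in> space ?C" "x \<in> {1..n}" "y \<in> {1..n}" for a b r x y
  proof -
    obtain cs m where h: "history t (a, b, r) = (cs, m)" by fastforce
    have "(a, b, r) \<in> space (alloc_upto n t)"
      using that by (simp add: alloc_upto_def space_pair_measure)
    then have m: "m \<in> St" using history_St[of "(a, b, r)" t t] h by simp
    show ?thesis
      unfolding history_Suc history_upd h P_def
      by (simp add: measure_R[OF m that(4,5)] nn_integral_distr measurable_fg[OF m that(4,5)] split_beta)
  qed
  have "(\<integral>\<^sup>+\<omega>. F (history (Suc t) \<omega>) \<partial>alloc_upto n (Suc t)) =
      (\<integral>\<^sup>+a. \<integral>\<^sup>+x. \<integral>\<^sup>+b. \<integral>\<^sup>+y. \<integral>\<^sup>+r. P x y (history t (a, b, r)) \<partial>?C \<partial>?U \<partial>?A \<partial>?U \<partial>?A)"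
    using measurable_compose[OF history_measurable[OF order_refl], of F borel]
    by (subst nn_integral_alloc_upto_Suc[OF n_pos])
       (auto intro!: nn_integral_cong inner simp: space_uniform_count_measure)
  \<comment> \<open>The integrals over \<open>x\<close> and \<open>y\<close> lie between those over
    \<open>a\<close>, \<open>b\<close> and \<open>r\<close>; as finite sums they are pulled to the
    front by linearity.\<close>
  also have "\<dots> = (\<Sum>x\<in>{1..n}. (\<Sum>y\<in>{1..n}. \<integral>\<^sup>+a. \<integral>\<^sup>+b. \<integral>\<^sup>+r. P x y (history t (a, b, r)) \<partial>?C \<partial>?A \<partial>?A) / n) / n"
  proof -
    define J where "J x y a b = (\<integral>\<^sup>+r. P x y (history t (a, b, r)) \<partial>?C)" for x y a b
    have [measurable]: "(\<lambda>(a, b). J x y a b) \<in> borel_measurable (?A \<Otimes>\<^sub>M ?A)" for x y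
      unfolding J_def by measurable
    have "(\<integral>\<^sup>+a. \<integral>\<^sup>+x. \<integral>\<^sup>+b. \<integral>\<^sup>+y. J x y a b \<partial>?U \<partial>?A \<partial>?U \<partial>?A) =
        (\<integral>\<^sup>+a. (\<Sum>x\<in>{1..n}. (\<Sum>y\<in>{1..n}. \<integral>\<^sup>+b. J x y a b \<partial>?A) / n) / n \<partial>?A)"
      unfolding sumU
    proof (intro nn_integral_cong sum.cong refl arg_cong[where f="\<lambda>s. s / of_nat n"])
      fix a x assume [measurable]: "a \<in> space ?A"
      show "(\<integral>\<^sup>+b. (\<Sum>y\<in>{1..n}. J x y a b) / n \<partial>?A) = (\<Sum>y\<in>{1..n}. \<integral>\<^sup>+b. J x y a b \<partial>?A) / n"
        by (subst nn_integral_divide, measurable, subst nn_integral_sum) measurable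
    qed
    also have "\<dots> = (\<integral>\<^sup>+a. (\<Sum>x\<in>{1..n}. (\<Sum>y\<in>{1..n}. \<integral>\<^sup>+b. J x y a b \<partial>?A) / n) \<partial>?A) / n"
      by (rule nn_integral_divide) measurable
    also have "\<dots> = (\<Sum>x\<in>{1..n}. \<integral>\<^sup>+a. (\<Sum>y\<in>{1..n}. \<integral>\<^sup>+b. J x y a b \<partial>?A) / n \<partial>?A) / n"
      by (subst nn_integral_sum) measurable
    also have "\<dots> = (\<Sum>x\<in>{1..n}. (\<Sum>y\<in>{1..n}. \<integral>\<^sup>+a. \<integral>\<^sup>+b. J x y a b \<partial>?A \<partial>?A) / n) / n"
      by (intro sum.cong refl arg_cong[where f="\<lambda>s. s / of_nat n"], subst nn_integral_divide, measurable,
          subst nn_integral_sum) measurable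
    finally show ?thesis by (simp only: J_def)
  qed
  also have "\<dots> = (\<Sum>x\<in>{1..n}. (\<Sum>y\<in>{1..n}. \<integral>\<^sup>+\<omega>. P x y (history t \<omega>) \<partial>alloc_upto n t) / n) / n"
    by (simp add: nn_integral_alloc_upto[OF n_pos meas])
  also have "\<dots> = (\<integral>\<^sup>+\<omega>. (\<Sum>x\<in>{1..n}. (\<Sum>y\<in>{1..n}. P x y (history t \<omega>)) / n) / n \<partial>alloc_upto n t)"
    using meas by (simp add: nn_integral_sum nn_integral_divide)
  also have "\<dots> = (\<integral>\<^sup>+\<omega>. (\<integral>\<^sup>+h. F h \<partial>measure_pmf (step (history t \<omega>))) \<partial>alloc_upto n t)"
    using ne by (simp add: step_def K_def P_def nn_integral_pmf_of_set case_prod_unfold)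
  finally show ?thesis .
qed

lemma nn_integral_history:
  "(\<integral>\<^sup>+\<omega>. F (history t \<omega>) \<partial>alloc_upto n t) = (\<integral>\<^sup>+h. F h \<partial>measure_pmf (run t ([], m1)))"
proof (induction t arbitrary: F)
  case 0
  interpret prob_space "alloc_upto n 0" by (rule prob_space_alloc_upto[OF n_pos])
  have "history 0 = (\<lambda>_. ([], m1))" by (auto simp: history_def)
  then show ?case by (simp add: emeasure_space_1)
next
  case (Suc t)
  have "run 0 = return_pmf" by (rule ext) simp
  then have "run (Suc 0) = step" by (intro ext) (simp add: bind_return_pmf')
  \<comment> \<open>\<open>run\<close> unfolds at the first ball, while the history grows at the
    last one; \<open>run_add\<close> moves the extra step to the end.\<close>
  then have "run (Suc t) ([], m1) = bind_pmf (run t ([], m1)) step"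
    using run_add[of t "Suc 0" "([], m1)"] by simp
  then show ?case by (simp add: nn_integral_history_Suc Suc.IH[of "\<lambda>h. \<integral>\<^sup>+h'. F h' \<partial>measure_pmf (step h)"])
qed

lemma prob_history:
  "measure (allocation_space n) {\<omega> \<in> space (allocation_space n). Q (history n \<omega>)} =
    measure_pmf.prob (run n ([], m1)) {h. Q h}"
proof -
  let ?N = "alloc_upto n n"
  have S: "{\<omega> \<in> space ?N. Q (history n \<omega>)} \<in> sets ?N"
    using measurable_sets[OF history_measurable[OF order_refl], of "{h. Q h}" n]
    by (simp add: vimage_def Int_def conj_commute)
  have "emeasure ?N {\<omega> \<in> space ?N. Q (history n \<omega>)} = (\<integral>\<^sup>+\<omega>. indicator {h. Q h} (history n \<omega>) \<partial>?N)"
    by (subst nn_integral_indicator[OF S, symmetric]) (auto intro!: nn_integral_cong simp: indicator_def)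
  then show ?thesis
    by (simp add: nn_integral_history allocation_space_eq measure_def)
qed

section \<open>From the history to the maximum load\<close>

lemma load_eq: "load n m1 f g \<omega> i = count_list (fst (history n \<omega>)) i"
proof -
  have "count_list (map h [0..<t]) i = card {s. s < t \<and> h s = i}" for h :: "nat \<Rightarrow> nat" and t
  proof (induction t)
    case (Suc t)
    have "{s. s < Suc t \<and> h s = i} = (if h t = i then insert t else id) {s. s < t \<and> h s = i}"
      by (auto simp: less_Suc_eq)
    with Suc show ?case by simp
  qed simp
  then show ?thesis by (simp add: load_def history_def)
qed

lemma prob_max_load:
  "measure (allocation_space n) {\<omega> \<in> space (allocation_space n). k \<le> max_load n m1 f g \<omega>} =
    1 - measure_pmf.prob (run n ([], m1)) {h. heavy k (fst h) \<inter> {1..n} = {}}"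
proof -
  have "k \<le> max_load n m1 f g \<omega> \<longleftrightarrow> heavy k (fst (history n \<omega>)) \<inter> {1..n} \<noteq> {}" for \<omega>
    using n_pos by (subst max_load_def, subst Max_ge_iff) (auto simp: heavy_def load_eq)
  then have "measure (allocation_space n) {\<omega> \<in> space (allocation_space n). k \<le> max_load n m1 f g \<omega>} =
      measure_pmf.prob (run n ([], m1)) {h. heavy k (fst h) \<inter> {1..n} \<noteq> {}}"
    using prob_history[of "\<lambda>h. heavy k (fst h) \<inter> {1..n} \<noteq> {}"] by simp
  also have "\<dots> = 1 - measure_pmf.prob (run n ([], m1)) {h. heavy k (fst h) \<inter> {1..n} = {}}"
  proof -
    have "{h. heavy k (fst h) \<inter> {1..n} \<noteq> {}} =
        space (measure_pmf (run n ([], m1))) - {h. heavy k (fst h) \<inter> {1..n} = {}}"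
      by auto
    then show ?thesis by (simp only: measure_pmf.prob_compl sets_measure_pmf UNIV_I)
  qed
  finally show ?thesis .
qed

end

section \<open>Asymptotics\<close>

text \<open>Applied with \<open>i = k - 2\<close>, this lets a surplus of \<open>k - 2\<close>
  factors, each at least 4, absorb \<open>k ^ 2\<close>.\<close>

lemma square_le_four_power: "(real i + 2)\<^sup>2 \<le> 4 * 4 ^ i"
proof (induction i)
  case (Suc i)
  have "(real (Suc i) + 2)\<^sup>2 \<le> (2 * (real i + 2))\<^sup>2" by (intro power_mono) auto
  also have "\<dots> = 4 * (real i + 2)\<^sup>2" by (simp only: power_mult_distrib) simp
  also have "\<dots> \<le> 4 * 4 ^ Suc i" using Suc by simp
  finally show ?case .
qed simp

text \<open>\<open>w ^ 2 / 64\<close> is the gain of each factor \<open>64 k\<^sup>2\<close> over the \<open>ln n ^ 2\<close> that the exponent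
  \<open>\<delta>\<close> pays for; it leaves room both for the union bound over the \<open>2 ^ (M k)\<close> sequences of
  memory states and for a failure probability that tends to \<open>0\<close>.\<close>

lemma threshold_bounds:
  fixes n M k :: nat and \<delta> w :: real
  assumes w: "w = ln (ln n)" "200 \<le> w" and M: "real M = n powr (1 - \<delta>)"
    and k: "2 \<le> k" "k - 1 < \<delta> * ln n / (2 * w)" 
  shows "k \<le> n" and "w ^ 2 / 32768 \<le> n / 2 / (64 * real k ^ 2) ^ k"
    and "M * k \<le> 64 * real k ^ 2 * (n / 2 / (64 * real k ^ 2) ^ k)"
proof -
  define l where "l = ln (real n)"
  define B where "B = w ^ 2 / 64"
  define D where "D = 64 * real k ^ 2"
  have l: "0 < l" "exp w = l"
  proof -
    show "0 < l"
    proof (rule ccontr)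
      assume "\<not> 0 < l"
      \<comment> \<open>The convention \<open>ln 0 = 0\<close> excludes the degenerate cases: they
        would give \<open>w = 0\<close>.\<close>
      moreover have "l = 0 \<or> 0 < l \<or> n = 0" by (cases n) (auto simp: l_def)
      ultimately show False using w by (auto simp: l_def)
    qed
    then show "exp w = l" by (simp add: w(1) l_def)
  qed
  have n: "1 < n" using l(1) by (cases "n = 0"; cases "n = 1") (auto simp: l_def)
  have l1: "1 \<le> l" using w(2) l(2) by (smt (verit) one_le_exp_iff)
  have M1: "1 \<le> real M"
  proof -
    have "real M \<noteq> 0" using n by (simp add: M)
    then show ?thesis by simp
  qed
  have \<delta>: "\<delta> \<le> 1"
  proof (rule ccontr)
    assume "\<not> \<delta> \<le> 1"
    then have "n powr (1 - \<delta>) < n powr 0" using n by (intro powr_less_mono) auto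
    then show False using M M1 n by simp
  qed
  have wpos: "0 < w" using w(2) by simp
  have k1: "real (k - 1) * (2 * w) < \<delta> * l"
    using k(2) wpos by (simp add: l_def field_simps)
  \<comment> \<open>Only \<open>k - 1\<close> is known to lie below the threshold;
    \<open>k \<le> 2 * (k - 1)\<close> makes up for that and uses the 2 in the denominator.\<close>
  have kl: "real k * w \<le> l"
  proof -
    have "real k * w \<le> real (k - 1) * (2 * w)"
      using k(1) wpos by (simp add: of_nat_diff)
    also have "\<dots> \<le> \<delta> * l" using k1 by simp
    also have "\<dots> \<le> 1 * l" using \<delta> l by (intro mult_right_mono) auto
    finally show ?thesis by simp
  qed
  have "real k * 1 \<le> real k * w" using w(2) by (intro mult_left_mono) auto
  also note kl
  also have "l \<le> n" using n ln_le_minus_one[of "real n"] by (simp add: l_def)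
  finally show "k \<le> n" by simp
  have B: "4 \<le> B"
  proof -
    have "200 ^ 2 \<le> w ^ 2" using w(2) by (intro power_mono) auto
    then show ?thesis by (simp add: B_def)
  qed
  have Dpos: "0 < D" using k(1) by (simp add: D_def)
  \<comment> \<open>\<open>D * B\<close> is \<open>(k * w) ^ 2\<close>, hence at most
    \<open>l ^ 2\<close>. Its power \<open>k - 1\<close> is at most
    \<open>exp (2 * w * (k - 1)) \<le> n powr \<delta>\<close>, and multiplication by
    \<open>M\<close> gives at most \<open>n\<close>.\<close>
  have "(real k * w) ^ 2 \<le> l ^ 2" using kl wpos by (intro power_mono) auto
  then have "D * B \<le> l ^ 2" by (simp add: D_def B_def power_mult_distrib)
  then have "(D * B) ^ (k - 1) \<le> (l ^ 2) ^ (k - 1)"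
    using Dpos B by (intro power_mono) auto
  also have "\<dots> = exp (real (k - 1) * (2 * w))"
    unfolding l(2)[symmetric] by (simp add: exp_of_nat_mult[symmetric] power_mult[symmetric] mult_ac)
  also have "\<dots> \<le> exp (\<delta> * l)" using k1 by simp
  also have "\<dots> = n powr \<delta>" using n by (simp add: powr_def l_def)
  finally have "M * (D ^ (k - 1) * B ^ (k - 1)) \<le> n powr (1 - \<delta>) * n powr \<delta>"
    unfolding M[symmetric] by (intro mult_left_mono) (auto simp: power_mult_distrib)
  also have "\<dots> = n" using n by (simp add: powr_add[symmetric])
  finally have MB: "M * B ^ (k - 1) \<le> n / D ^ (k - 1)"
    using Dpos by (simp add: field_simps)
  define y where "y = n / 2 / D ^ k"
  have Dy: "D * y = n / D ^ (k - 1) / 2"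
    using Dpos k(1) by (cases k) (auto simp: y_def)
  obtain i where i: "k = Suc (Suc i)" using k(1) by (metis add_2_eq_Suc le_Suc_ex)
  have "real k ^ 2 \<le> 4 * 4 ^ i" using square_le_four_power[of i] by (simp add: i add.commute)
  also have "\<dots> \<le> 4 * B ^ i" using B by (intro mult_left_mono power_mono) auto
  finally have "B * real k ^ 2 \<le> B * (4 * B ^ i)" using B by (intro mult_left_mono) auto
  also have "\<dots> = 4 * B ^ (k - 1)" by (simp add: i)
  finally have "M * (B * real k ^ 2) \<le> M * (4 * B ^ (k - 1))" by (intro mult_left_mono) auto
  \<comment> \<open>Both remaining claims follow from this: \<open>1 \<le> M\<close> gives
    \<open>B \<le> 512 * y\<close>, where 32768 is 64 times 512, and
    \<open>8 * k \<le> B * k ^ 2\<close> gives the bound on \<open>M * k\<close>.\<close>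
  with MB have main: "M * (B * real k ^ 2) \<le> 8 * (D * y)" by (simp add: Dy)
  have "1 * (B * real k ^ 2) \<le> M * (B * real k ^ 2)"
    using M1 B by (intro mult_right_mono) auto
  also note main
  finally have "B * real k ^ 2 \<le> (512 * y) * real k ^ 2" by (simp add: D_def mult_ac)
  then have "B \<le> 512 * y" using k(1) by simp
  then show "w ^ 2 / 32768 \<le> n / 2 / (64 * real k ^ 2) ^ k"
    by (simp add: B_def y_def D_def)
  have "8 * real k \<le> B * real k ^ 2"
  proof -
    have "8 * real k \<le> (4 * real k) * real k" using k(1) by (intro mult_right_mono) auto
    also have "\<dots> \<le> B * real k ^ 2"
      using mult_right_mono[OF B, of "real k * real k"] by (simp add: power2_eq_square)
    finally show ?thesis .
  qed
  then have "M * (8 * real k) \<le> M * (B * real k ^ 2)" by (intro mult_left_mono) auto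
  with main have "M * k \<le> D * y" by simp
  then show "M * k \<le> 64 * real k ^ 2 * (n / 2 / (64 * real k ^ 2) ^ k)"
    by (simp add: y_def D_def)
qed

section \<open>The bound for a single strategy\<close>

context memory_strategy
begin

lemma card_St: "card St = 2 ^ M"
  using card_lists_length_eq[of "UNIV :: bool set" M] by (simp add: St_def)

text \<open>The first ball lands in some bin. This settles thresholds \<open>x \<le> 1\<close>, for
  which rounding up does not give the \<open>2 \<le> k\<close> of
  \<open>threshold_bounds\<close>.\<close>

lemma max_load_pos: "1 \<le> max_load n m1 f g \<omega>" if "\<omega> \<in> space (allocation_space n)"
proof -
  obtain a b r where \<omega>: "\<omega> = (a, b, r)" by (cases \<omega>)
  define c where "c = placement m1 f g \<omega> 0"
  have "a 0 \<in> {1..n}" "b 0 \<in> {1..n}"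
    using space_alloc_upto[of a b r n 0] that n_pos by (auto simp: \<omega> allocation_space_eq)
  have "c \<in> {1..n}"
  proof -
    have "m1 \<in> St" using strat by (simp add: St_def strategy_def)
    then have "c \<in> {a 0, b 0}"
      using fg(1)[of m1 "a 0" "b 0" "r 0"] \<open>a 0 \<in> {1..n}\<close> \<open>b 0 \<in> {1..n}\<close> by (simp add: c_def \<omega>)
    then show ?thesis using \<open>a 0 \<in> {1..n}\<close> \<open>b 0 \<in> {1..n}\<close> by blast
  qed
  moreover have "1 \<le> load n m1 f g \<omega> c"
  proof -
    have "{0} \<subseteq> {t. t < n \<and> placement m1 f g \<omega> t = c}" using n_pos by (auto simp: c_def)
    then have "card {0 :: nat} \<le> load n m1 f g \<omega> c"
      unfolding load_def by (intro card_mono) auto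
    then show ?thesis by simp
  qed
  ultimately show ?thesis
    unfolding max_load_def by (subst Max_ge_iff) auto
qed

lemma prob_max_load_ge:
  fixes \<delta> w x :: real
  assumes w: "w = ln (ln n)" "200 \<le> w" and M: "real M = n powr (1 - \<delta>)"
    and x: "x = \<delta> * ln n / (2 * w)"
  shows "1 - 2 * exp (- 3 * (w ^ 2 / 32768)) \<le>
    measure (allocation_space n) {\<omega> \<in> space (allocation_space n). x \<le> max_load n m1 f g \<omega>}"
proof (cases "x \<le> 1")
  case True
  interpret prob_space "allocation_space n"
    unfolding allocation_space_eq by (rule prob_space_alloc_upto[OF n_pos])
  have "{\<omega> \<in> space (allocation_space n). x \<le> max_load n m1 f g \<omega>} = space (allocation_space n)"
    using max_load_pos True by fastforce
  then show ?thesis by (simp add: prob_space)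
next
  case False
  \<comment> \<open>Loads are integers, so reaching \<open>x\<close> is the same as reaching its
    ceiling.\<close>
  define k where "k = nat \<lceil>x\<rceil>"
  define y where "y = n / 2 / (64 * real k ^ 2) ^ k"
  have k: "2 \<le> k" "k - 1 < x" "x \<le> k" using False unfolding k_def by linarith+
  note bounds = threshold_bounds[OF w M k(1), folded x, OF k(2), folded y_def]
  \<comment> \<open>The bound 200 on \<open>w\<close> is large enough because its square 40000
    exceeds 32768.\<close>
  have "200 ^ 2 \<le> w ^ 2" using w(2) by (intro power_mono) auto
  then have y1: "1 \<le> y" using bounds(2) by simp
  have "real (card St) ^ k = 2 ^ (M * k)" by (simp add: card_St power_mult)
  also have "\<dots> \<le> exp 1 ^ (M * k)"
    using exp_ge_add_one_self[of "1 :: real"] by (intro power_mono) auto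
  also have "\<dots> = exp (M * k)" by (simp flip: exp_of_nat_mult)
  also have "\<dots> \<le> exp (64 * real k ^ 2 * y)" using bounds(3) by simp
  finally have "measure_pmf.prob (run n ([], m1)) {h'. heavy k (fst h') \<inter> {1..n} = {}} \<le> 2 * exp (- 3 * y)"
    using k(1) bounds(1) y1 strat by (intro prob_no_heavy) (auto simp: y_def St_def strategy_def)
  also have "\<dots> \<le> 2 * exp (- 3 * (w ^ 2 / 32768))" using bounds(2) by simp
  finally have "1 - 2 * exp (- 3 * (w ^ 2 / 32768)) \<le>
      measure (allocation_space n) {\<omega> \<in> space (allocation_space n). k \<le> max_load n m1 f g \<omega>}"
    unfolding prob_max_load by simp
  also have "{\<omega> \<in> space (allocation_space n). k \<le> max_load n m1 f g \<omega>} =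
      {\<omega> \<in> space (allocation_space n). x \<le> max_load n m1 f g \<omega>}"
    using k(3) False unfolding k_def by (auto simp: nat_le_iff ceiling_le_iff)
  finally show ?thesis .
qed

end

theorem theorem1:
  "\<exists>\<epsilon> :: nat \<Rightarrow> real. \<epsilon> \<longlonglongrightarrow> 0 \<and>
     (\<forall>(n :: nat) (M :: nat) (\<delta> :: real) m1 f g.
        real M = real n powr (1 - \<delta>) \<longrightarrow> real M < real n / ln (real n) \<longrightarrow> strategy n M m1 f g \<longrightarrow>
        measure (allocation_space n)
          {\<omega> \<in> space (allocation_space n).
             real (max_load n m1 f g \<omega>) \<ge> \<delta> * ln (real n) / (2 * ln (ln (real n)))}
        \<ge> 1 - \<epsilon> n)"
proof -
  \<comment> \<open>Small \<open>n\<close> get the value 1, for which the claim is trivial. The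
    value depends on \<open>n\<close> alone, so the bound is uniform in \<open>\<delta>\<close> and
    the strategy.\<close>
  define \<epsilon> :: "nat \<Rightarrow> real" where
    "\<epsilon> n = (if 200 \<le> ln (ln n) then 2 * exp (- 3 * (ln (ln n) ^ 2 / 32768)) else 1)" for n
  have "(\<lambda>n :: nat. 2 * exp (- 3 * (ln (ln n) ^ 2 / 32768)) :: real) \<longlonglongrightarrow> 0"
    by real_asymp
  moreover have "\<forall>\<^sub>F n :: nat in sequentially. 200 \<le> ln (ln (real n))"
    by real_asymp
  then have "\<forall>\<^sub>F n in sequentially. 2 * exp (- 3 * (ln (ln n) ^ 2 / 32768)) = \<epsilon> n"
    by eventually_elim (simp add: \<epsilon>_def)
  ultimately have "\<epsilon> \<longlonglongrightarrow> 0"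
    by (rule Lim_transform_eventually)
  moreover have "1 - \<epsilon> n \<le> measure (allocation_space n)
      {\<omega> \<in> space (allocation_space n). \<delta> * ln n / (2 * ln (ln n)) \<le> max_load n m1 f g \<omega>}"
    if M: "real M = real n powr (1 - \<delta>)" and strat: "strategy n M m1 f g" for n M \<delta> m1 f g
  proof (cases "200 \<le> ln (ln (real n))")
    case True
    then have "0 < n" by (cases "n = 0") auto
    then interpret memory_strategy n M m1 f g using strat by unfold_locales
    show ?thesis using prob_max_load_ge[OF refl True M refl] True by (simp add: \<epsilon>_def)
  next
    case False
    then show ?thesis by (simp add: \<epsilon>_def)
  qed
  ultimately show ?thesis by blast
qed

end
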